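(* For every integer $n\geq 0$, $$ S_n = (-1)^{n+1}\, n! \int_0^{+\infty} \frac{1}{t^n}\left(\frac{1}{1-e^{-t}} - \sum_{k=-1}^{n} b_k t^{k} - r_n t^{n+1}\right)\frac{e^{-t}\,dt}{t}, $$ where $r_n$ is the rational number $$ r_n=\sum_{k=1}^{n+1} \frac{(-1)^{k+1}}{k!}\, b_{n-k}\, H_{k}. $$
   Context: For an integer $n\geq 0$, the Stirling-Ramanujan constant $S_n$ is the constant term in the asymptotic expansion, as the integer $s\to+\infty$, $$\sum_{k=1}^s k^n\log k = A_n(s)\log s + B_n(s) + S_n + R_n(1/s),$$ where $A_n\in\mathbb{Q}[s]$, $B_n\in s\mathbb{Q}[s]$ (polynomial without constant term), and $R_n(1/s)\in \frac1s\mathbb{Q}[[\frac1s]]$ is the decaying part, in particular $R_n(1/s)=O(1/s)$. (E.g. $S_0=\frac{\log 2\pi}{2}$.) The numbers $b_k$, $k\geq -1$, are defined by the Laurent expansion $\frac{1}{1-e^{-t}}=\sum_{k=-1}^{+\infty} b_k t^k$; equivalently $b_k=(-1)^{k+1}\frac{B_{k+1}}{(k+1)!}$ with $B_j$ the Bernoulli numbers. $H_k=1+\frac12+\cdots+\frac1k$ denotes the $k$-th harmonic number. *)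

theory Defs
  imports
    "HOL-Analysis.Analysis"
    "HOL-Computational_Algebra.Formal_Laurent_Series"
    "HOL-Library.Landau_Symbols"
begin

text \<open>
  The series \<open>R\<close> need not converge, so \<open>R(1/s)\<close> is read in the sense of (Poincare) asymptotic
  expansions: truncating at order \<open>N\<close> leaves an error \<open>O(1/s^(N+1))\<close>, for every \<open>N\<close>.
\<close>

definition stirling_ramanujan_expansion ::
  "nat \<Rightarrow> rat poly \<Rightarrow> rat poly \<Rightarrow> real \<Rightarrow> rat fps \<Rightarrow> bool" where
  "stirling_ramanujan_expansion n A B S R \<longleftrightarrow>
     poly.coeff B 0 = 0 \<and> fps_nth R 0 = 0 \<and>
     (\<forall>N. (\<lambda>s::nat. (\<Sum>k=1..s. real k ^ n * ln (real k))
             - (poly (map_poly of_rat A) (real s) * ln (real s)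
                + poly (map_poly of_rat B) (real s)
                + S
                + (\<Sum>j\<le>N. of_rat (fps_nth R j) * (1 / real s) ^ j)))
          \<in> O(\<lambda>s. (1 / real s) ^ (N + 1)))"

definition stirling_ramanujan :: "nat \<Rightarrow> real" where
  "stirling_ramanujan n = (THE S. \<exists>A B R. stirling_ramanujan_expansion n A B S R)"

text \<open>The coefficients of the Laurent expansion of \<open>1/(1 - e^(-t))\<close> at \<open>t = 0\<close>.\<close>

definition todd_coeff :: "int \<Rightarrow> rat" where
  "todd_coeff k = fls_nth (1 / (1 - fps_to_fls (fps_exp (- 1)))) k"

definition r_coeff :: "nat \<Rightarrow> real" where
  "r_coeff n = (\<Sum>k=1..n+1. (- 1) ^ (k + 1) / fact k * of_rat (todd_coeff (int n - int k)) * harm k)"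

definition sr_integrand :: "nat \<Rightarrow> real \<Rightarrow> real" where
  "sr_integrand n t =
     1 / t ^ n
     * (1 / (1 - exp (- t)) - (\<Sum>k=-1..int n. of_rat (todd_coeff k) * t powi k)
        - r_coeff n * t ^ (n + 1))
     * (exp (- t) / t)"

end

theory Submission
  imports Defs "HOL-Real_Asymp.Real_Asymp" "HOL-Probability.Distributions"
begin

text \<open>
  Write \<open>todd i = b_(i-1)\<close>, \<open>N = n + 1\<close> and \<open>L_p(x) = x^p / p! (ln x - H_p)\<close>. The functions \<open>L_p\<close> are
  regularised integrals of \<open>e^(-x t) / t^(p+1)\<close>. Hence, with \<open>I(x)\<close> the integral of
  \<open>t^(-N) (1/(1 - e^(-t)) - \<Sum>\<^sub>i\<^sub>\<le>\<^sub>N b_(i-1) t^(i-1)) e^(-x t)\<close> over the half-line, the relation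
  \<open>(1 - e^(-t)) \<Sum> b_k t^k = 1\<close> turns into a functional equation: the sum of the elementary function
  \<open>\<Sum>\<^sub>i\<^sub>\<le>\<^sub>N (-1)^i b_(i-1) L_(N-i)(x)\<close> and \<open>(-1)^n I(x)\<close> has forward difference \<open>L_n(x)\<close>.
  Telescoping expresses \<open>\<Sum> k^n ln k\<close> through elementary terms and \<open>I(s)\<close>, \<open>I(1)\<close>. By Watson's lemma \<open>I(s)\<close>
  only contributes to the decaying part of the expansion, so \<open>I(1)\<close> and the values of the elementary terms
  at \<open>1\<close>, which make up \<open>r_n\<close>, give the constant. That constant is unique because the functions
  \<open>s^j\<close> and \<open>s^j ln s\<close> are asymptotically independent.
\<close>

section \<open>The expansion of \<open>1/(1 - e^(-t))\<close>\<close>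

text \<open>The index shift makes these the Taylor coefficients of t / (1 - e^(-t)), so that
  ordinary power series can replace Laurent series once \<open>todd_coeff_convolution\<close> is
  available.\<close>

definition todd :: "nat \<Rightarrow> real" where
  "todd i = of_rat (todd_coeff (int i - 1))"

text \<open>Since 1 - e^(-X) = X * \<open>E1\<close> with \<open>E1\<close> a unit, the Laurent
  series 1 / (1 - e^(-X)) is \<open>inverse E1\<close> divided by X; the shift by one index is that
  division.\<close>

lemma todd_coeff_convolution:
  "Abs_fps (\<lambda>i. todd_coeff (int i - 1)) * (1 - fps_exp (- 1)) = fps_X"
proof -
  define E :: "rat fps" where "E = 1 - fps_exp (- 1)"
  define E1 where "E1 = fps_shift 1 E"
  define C where "C = inverse E1"
  have E0: "fps_nth E 0 = 0" by (simp add: E_def)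
  have E1: "fps_nth E 1 = 1" by (simp add: E_def)
  have "fps_nth E1 0 = 1" using E1 by (simp add: E1_def)
  then have "C * E1 = 1" unfolding C_def by (intro inverse_mult_eq_1) simp
  moreover have EE: "E = fps_X * E1"
    by (intro fps_ext) (auto simp: E1_def E0)
  ultimately have CE: "C * E = fps_X" by (simp add: algebra_simps)
  have "E \<noteq> 0" using E1 by auto
  then have nz: "fps_to_fls E \<noteq> 0" by simp
  have "fps_to_fls C * fps_to_fls E = fls_X"
    using arg_cong[OF CE, of fps_to_fls] by (simp add: fls_times_fps_to_fls)
  then have C: "fps_to_fls C = fls_X * (1 / fps_to_fls E)"
    using nz by (simp add: field_simps)
  have "todd_coeff (int i - 1) = fps_nth C i" for i
  proof -
    have "fps_nth C i = fls_nth (fps_to_fls C) (int i)" by simp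
    also have "\<dots> = todd_coeff (int i - 1)"
      unfolding C fls_X_times_conv_shift(1) by (simp add: todd_coeff_def E_def)
    finally show ?thesis by simp
  qed
  then have "Abs_fps (\<lambda>i. todd_coeff (int i - 1)) = C" by (intro fps_ext) simp
  with CE show ?thesis by (simp add: E_def)
qed

lemma of_rat_fact: "of_rat (fact n) = fact n"
  by (metis of_nat_fact of_rat_of_nat_eq)

lemma todd_convolution: "Abs_fps todd * (1 - fps_exp (- 1)) = fps_X"
proof (rule fps_ext)
  fix m
  have "fps_nth (Abs_fps todd * (1 - fps_exp (- 1))) m =
      of_rat (fps_nth (Abs_fps (\<lambda>i. todd_coeff (int i - 1)) * (1 - fps_exp (- 1))) m)"
    by (auto simp: fps_mult_nth todd_def of_rat_sum of_rat_mult of_rat_diff of_rat_divide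
        of_rat_power of_rat_minus of_rat_fact intro!: sum.cong)
  then show "fps_nth (Abs_fps todd * (1 - fps_exp (- 1))) m = fps_nth fps_X m"
    by (simp add: todd_coeff_convolution fps_X_def)
qed

text \<open>Multiply \<open>todd_convolution\<close> by e^(yX) and compare coefficients of X^(m+1).
  Up to the factor (m+1)!, the sums of \<open>todd i\<close> * y^(m+1-i) / (m+1-i)! are Bernoulli
  polynomials in y + 1, and this is their difference equation in backward form.\<close>

lemma todd_difference:
  "(\<Sum>i\<le>Suc m. todd i * ((y ^ (Suc m - i) - (y - 1) ^ (Suc m - i)) / fact (Suc m - i)))
     = y ^ m / fact m"
proof -
  have "(1 - fps_exp (- 1)) * fps_exp y = fps_exp y - fps_exp (y - 1)"
    by (simp add: algebra_simps flip: fps_exp_add_mult)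
  then have "Abs_fps todd * (fps_exp y - fps_exp (y - 1)) = fps_X * fps_exp y"
    by (metis mult.assoc todd_convolution)
  from arg_cong[OF this, of "\<lambda>F. fps_nth F (Suc m)"] show ?thesis
    unfolding fps_X_mult_nth
    by (simp add: fps_mult_nth atMost_atLeast0 diff_divide_distrib del: sum.cl_ivl_Suc)
qed

text \<open>Substituting y = -x turns the backward difference into the forward difference needed for
  telescoping.\<close>

lemma todd_difference_signed:
  "(\<Sum>i\<le>Suc m. (- 1) ^ i * todd i * (((x + 1) ^ (Suc m - i) - x ^ (Suc m - i)) / fact (Suc m - i)))
     = x ^ m / fact m"
proof -
  have "(\<Sum>i\<le>Suc m. (- 1) ^ i * todd i * (((x + 1) ^ (Suc m - i) - x ^ (Suc m - i)) / fact (Suc m - i)))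
      = (- 1) ^ m * (\<Sum>i\<le>Suc m. todd i * (((- x) ^ (Suc m - i) - (- x - 1) ^ (Suc m - i)) / fact (Suc m - i)))"
    unfolding sum_distrib_left
  proof (rule sum.cong)
    fix i assume i: "i \<in> {..Suc m}"
    have neg: "- x - 1 = - (x + 1)" by simp
    have "(- 1) ^ i = - ((- 1) ^ m * (- 1 :: real) ^ (Suc m - i))"
    proof -
      have "(- 1 :: real) ^ (Suc m - i) * (- 1) ^ i = - ((- 1) ^ m)"
        using i by (simp flip: power_add)
      then show ?thesis
        by (cases "even m"; cases "even i"; cases "even (Suc m - i)") auto
    qed
    then show "(- 1) ^ i * todd i * (((x + 1) ^ (Suc m - i) - x ^ (Suc m - i)) / fact (Suc m - i))
      = (- 1) ^ m * (todd i * (((- x) ^ (Suc m - i) - (- x - 1) ^ (Suc m - i)) / fact (Suc m - i)))"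
      unfolding neg power_minus[of x] power_minus[of "x + 1"] by (simp add: field_simps)
  qed auto
  also have "\<dots> = (- 1) ^ m * ((- x) ^ m / fact m)"
    by (simp only: todd_difference)
  also have "\<dots> = x ^ m / fact m"
    by (simp flip: power_mult_distrib)
  finally show ?thesis .
qed

text \<open>The bound must hold on the whole half-line because it is integrated later. Near 0 it
  comes from the power series; away from 0 every term grows at most like t^M.\<close>

lemma todd_expansion_bound:
  obtains K where "\<And>t. t > 0 \<Longrightarrow> \<bar>1 / (1 - exp (- t)) - (\<Sum>i\<le>M. todd i * t ^ i / t)\<bar> \<le> K * t ^ M"
proof -
  define E1 :: "real fps" where "E1 = fps_shift 1 (1 - fps_exp (- 1))"
  have E10: "fps_nth E1 0 = 1" by (simp add: E1_def)
  \<comment> \<open>\<open>e1\<close> fills the removable singularity of (1 - e^(-t)) / t, so that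
    its reciprocal has an expansion at 0, with coefficients \<open>todd\<close>.\<close>
  define e1 where "e1 = (\<lambda>t::real. if t = 0 then 1 else (1 - exp (- t)) / t)"
  have "(\<lambda>t::real. 1 - exp (- t)) has_fps_expansion (1 - fps_exp (- 1))"
    by (intro fps_expansion_intros)
  then have "(\<lambda>x::real. if x = 0 then fps_nth (1 - fps_exp (- 1)) 1 else (1 - exp (- x)) / x ^ 1)
      has_fps_expansion E1"
    unfolding E1_def by (intro has_fps_expansion_shift) (auto intro!: subdegree_geI)
  then have e1: "e1 has_fps_expansion E1"
    by (simp add: e1_def cong: if_cong)
  then have inv: "(\<lambda>t. inverse (e1 t)) has_fps_expansion inverse E1"
    by (intro fps_expansion_intros) (auto simp: E10)
  have "Abs_fps todd * E1 = 1"
  proof -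
    have "1 - fps_exp (- 1) = fps_X * E1" by (intro fps_ext) (auto simp: E1_def)
    then have "fps_X * (Abs_fps todd * E1) = fps_X * 1"
      using todd_convolution by (metis mult.left_commute mult_1_right)
    then show ?thesis by (simp only: mult_cancel_left) simp
  qed
  then have iE: "inverse E1 = Abs_fps todd"
    using E10 by (metis fps_inverse_unique mult.commute)
  \<comment> \<open>\<open>G\<close> is the Taylor tail beyond order M. Near 0 the error of the
    truncation is t^M times its sum \<open>g\<close>, which is bounded there by continuity.\<close>
  define G where "G = fps_shift (Suc M) (Abs_fps todd)"
  define g where "g = eval_fps G"
  have "fps_conv_radius (Abs_fps todd) > 0" using inv unfolding iE by (simp add: has_fps_expansion_def)
  then have g: "g has_fps_expansion G"
    unfolding g_def G_def by (intro eval_fps_has_fps_expansion) simp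
  have "Abs_fps todd = (\<Sum>i\<le>M. fps_const (todd i) * fps_X ^ i) + fps_X ^ Suc M * G"
    by (intro fps_ext) (auto simp: G_def fps_sum_nth fps_X_power_mult_nth if_distrib[of "\<lambda>x. _ * x"]
        simp del: power_Suc cong: if_cong)
  then have "(\<lambda>t. (\<Sum>i\<le>M. todd i * t ^ i) + t ^ Suc M * g t) has_fps_expansion Abs_fps todd"
    by (auto intro!: fps_expansion_intros g simp del: power_Suc)
  with inv have "eventually (\<lambda>t. inverse (e1 t) = (\<Sum>i\<le>M. todd i * t ^ i) + t ^ Suc M * g t) (nhds 0)"
    unfolding iE has_fps_expansion_def by (auto elim: eventually_elim2)
  moreover have "continuous (at 0) g" using g by (rule has_fps_expansion_imp_continuous)
  then have "(g \<longlongrightarrow> g 0) (at 0)" by (simp add: continuous_at)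
  then have "eventually (\<lambda>t. dist (g t) (g 0) < 1) (at 0)" by (rule tendstoD) simp
  ultimately have "eventually (\<lambda>t. inverse (e1 t) = (\<Sum>i\<le>M. todd i * t ^ i) + t ^ Suc M * g t \<and>
      dist (g t) (g 0) < 1) (at 0)"
    by (auto simp: eventually_at_filter elim: eventually_elim2)
  then obtain d where d: "d > 0" "\<And>t. t \<noteq> 0 \<Longrightarrow> dist t 0 < d \<Longrightarrow> dist (g t) (g 0) < 1"
     "\<And>t. t \<noteq> 0 \<Longrightarrow> dist t 0 < d \<Longrightarrow> inverse (e1 t) = (\<Sum>i\<le>M. todd i * t ^ i) + t ^ Suc M * g t"
    unfolding eventually_at by auto
  define K1 where "K1 = \<bar>g 0\<bar> + 1"
  \<comment> \<open>The triangle-inequality bound of the error at t = d, divided by d^M: from d to a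
    larger t each term gains at most the factor (t/d)^M.\<close>
  define K2 where "K2 = (1 / (1 - exp (- d)) + (\<Sum>i\<le>M. \<bar>todd i\<bar> * d ^ i / d)) / d ^ M"
  have pos: "1 - exp (- t) > 0" if "t > 0" for t :: real using that by simp
  have K2: "K2 \<ge> 0" unfolding K2_def using d pos[of d]
    by (intro divide_nonneg_pos add_nonneg_nonneg sum_nonneg) auto
  show ?thesis
  proof (rule that[of "max K1 K2"])
    fix t :: real assume t: "t > 0"
    have "\<bar>1 / (1 - exp (- t)) - (\<Sum>i\<le>M. todd i * t ^ i / t)\<bar> \<le> (if t < d then K1 else K2) * t ^ M"
    proof (cases "t < d")
      case True
      have "\<bar>g t\<bar> \<le> K1" using d(2)[of t] True t by (auto simp: K1_def dist_real_def)
      moreover have "1 / (1 - exp (- t)) - (\<Sum>i\<le>M. todd i * t ^ i / t) = g t * t ^ M"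
        using d(3)[of t] True t by (simp add: e1_def field_simps flip: sum_divide_distrib)
      ultimately show ?thesis using t True by (simp add: abs_mult mult_right_mono)
    next
      case False
      have dt: "1 \<le> t / d" using False d by simp
      have "\<bar>1 / (1 - exp (- t)) - (\<Sum>i\<le>M. todd i * t ^ i / t)\<bar>
          \<le> \<bar>1 / (1 - exp (- t))\<bar> + \<bar>\<Sum>i\<le>M. todd i * t ^ i / t\<bar>"
        by (rule abs_triangle_ineq4)
      also have "\<dots> \<le> 1 / (1 - exp (- t)) + (\<Sum>i\<le>M. \<bar>todd i\<bar> * t ^ i / t)"
        using pos[OF t] t by (intro add_mono order.trans[OF sum_abs]) (auto simp: abs_mult)
      also have "\<dots> \<le> 1 / (1 - exp (- d)) * (t / d) ^ M + (\<Sum>i\<le>M. \<bar>todd i\<bar> * d ^ i / d * (t / d) ^ M)"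
      proof (intro add_mono sum_mono)
        have "1 / (1 - exp (- t)) \<le> 1 / (1 - exp (- d)) * 1"
          using pos[OF t] pos[OF d(1)] False by (simp add: frac_le)
        also have "\<dots> \<le> 1 / (1 - exp (- d)) * (t / d) ^ M"
          using pos[OF d(1)] dt by (intro mult_left_mono one_le_power) auto
        finally show "1 / (1 - exp (- t)) \<le> 1 / (1 - exp (- d)) * (t / d) ^ M" .
      next
        fix i assume i: "i \<in> {..M}"
        \<comment> \<open>The ratio is kept as a quotient because its exponent i - 1 is negative for
          i = 0; dropping the divisor t / d \<ge> 1 can only increase it.\<close>
        have "(t / d) ^ i / (t / d) \<le> (t / d) ^ i / 1" using dt by (intro divide_left_mono) auto
        also have "\<dots> = (t / d) ^ i" by simp
        also have "\<dots> \<le> (t / d) ^ M" using dt i by (intro power_increasing) auto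
        finally have "\<bar>todd i\<bar> * d ^ i / d * ((t / d) ^ i / (t / d)) \<le> \<bar>todd i\<bar> * d ^ i / d * (t / d) ^ M"
          using d by (intro mult_left_mono) auto
        then show "\<bar>todd i\<bar> * t ^ i / t \<le> \<bar>todd i\<bar> * d ^ i / d * (t / d) ^ M"
          using d by (simp add: power_divide)
      qed
      also have "\<dots> = K2 * t ^ M"
        unfolding K2_def power_divide sum_distrib_right[symmetric] distrib_right[symmetric] by simp
      finally show ?thesis using False by simp
    qed
    also have "\<dots> \<le> max K1 K2 * t ^ M" using t by (intro mult_right_mono) auto
    finally show "\<bar>1 / (1 - exp (- t)) - (\<Sum>i\<le>M. todd i * t ^ i / t)\<bar> \<le> max K1 K2 * t ^ M" .
  qed
qed

section \<open>Regularised integrals of exponentials\<close>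

text \<open>Convergence and value travel together, so the linear rules below carry no separate
  integrability conditions.\<close>

definition has_half_line_integral :: "(real \<Rightarrow> real) \<Rightarrow> real \<Rightarrow> bool" where
  "has_half_line_integral f I \<longleftrightarrow> has_bochner_integral lborel (\<lambda>t. indicator {0<..} t * f t) I"

lemma has_half_line_integral_iff:
  "has_half_line_integral f I \<longleftrightarrow> set_integrable lborel {0<..} f \<and> (LBINT t:{0<..}. f t) = I"
  by (simp add: has_half_line_integral_def has_bochner_integral_iff set_integrable_def
      set_lebesgue_integral_def)

lemma has_half_line_integral_unique:
  "has_half_line_integral f I \<Longrightarrow> has_half_line_integral f J \<Longrightarrow> I = J"
  by (simp add: has_half_line_integral_iff)

lemma has_half_line_integral_cong:
  assumes "has_half_line_integral f I" "\<And>t. t > 0 \<Longrightarrow> f t = g t" "I = J"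
  shows "has_half_line_integral g J"
proof -
  have "(\<lambda>t. indicator {0<..} t * f t) = (\<lambda>t. indicator {0<..} t * g t)"
    using assms(2) by (auto simp: indicator_def)
  with assms show ?thesis by (simp add: has_half_line_integral_def)
qed

lemma has_half_line_integral_cmult:
  "has_half_line_integral f I \<Longrightarrow> has_half_line_integral (\<lambda>t. c * f t) (c * I)"
  unfolding has_half_line_integral_def
  using has_bochner_integral_mult_right[of c lborel "\<lambda>t. indicator {0<..} t * f t" I]
  by (simp add: mult_ac)

lemma has_half_line_integral_diff:
  "has_half_line_integral f I \<Longrightarrow> has_half_line_integral g J \<Longrightarrow>
    has_half_line_integral (\<lambda>t. f t - g t) (I - J)"
  unfolding has_half_line_integral_def
  by (drule (1) has_bochner_integral_diff) (simp add: algebra_simps)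

lemma has_half_line_integral_sum:
  "(\<And>i. i \<in> A \<Longrightarrow> has_half_line_integral (f i) (I i)) \<Longrightarrow>
    has_half_line_integral (\<lambda>t. \<Sum>i\<in>A. f i t) (\<Sum>i\<in>A. I i)"
  unfolding has_half_line_integral_def
  by (drule has_bochner_integral_sum) (simp add: sum_distrib_left)

text \<open>For a nonnegative derivative, limits of the antiderivative at both ends already force
  absolute convergence.\<close>

lemma has_half_line_integral_FTC_nonneg:
  fixes f F :: "real \<Rightarrow> real"
  assumes "\<And>t. t > 0 \<Longrightarrow> (F has_real_derivative f t) (at t)"
    and "\<And>t. t > 0 \<Longrightarrow> isCont f t"
    and "\<And>t. t > 0 \<Longrightarrow> f t \<ge> 0"
    and "(F \<longlongrightarrow> A) (at_right 0)" and "(F \<longlongrightarrow> B) at_top"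
  shows "has_half_line_integral f (B - A)"
proof -
  have A: "((F \<circ> real_of_ereal) \<longlongrightarrow> A) (at_right 0)"
    using assms(4) by (simp add: zero_ereal_def ereal_tendsto_simps1)
  have B: "((F \<circ> real_of_ereal) \<longlongrightarrow> B) (at_left \<infinity>)"
    using assms(5) by (simp add: ereal_tendsto_simps1)
  have "set_integrable lborel (einterval 0 \<infinity>) f" "(LBINT x=0..\<infinity>. f x) = B - A"
    using assms(1-3) by (auto intro!: interval_integral_FTC_nonneg[OF _ _ _ _ A B])
  moreover have "einterval 0 \<infinity> = {0<..}" by (auto simp: einterval_def)
  ultimately show ?thesis
    by (simp add: has_half_line_integral_iff interval_lebesgue_integral_def)
qed

lemma has_half_line_integral_power_exp:
  assumes "a > 0"
  shows "has_half_line_integral (\<lambda>t. t ^ m * exp (- a * t)) (fact m / a ^ Suc m)"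
proof -
  \<comment> \<open>The Erlang density lives on the closed half-line, so the integrands may differ
    at t = 0. The factor \<open>a\<close> below is the normalisation of that density.\<close>
  have ae: "AE t in lborel. t \<noteq> (0::real)" by (rule AE_lborel_singleton)
  have "(\<integral>\<^sup>+t. ennreal (indicator {0<..} t * (a * (t ^ m * exp (- a * t)))) \<partial>lborel)
      = (\<integral>\<^sup>+t. ennreal (erlang_density 0 a t * t ^ m) \<partial>lborel)"
    by (rule nn_integral_cong_AE, rule eventually_mono[OF ae])
       (auto simp: erlang_density_def indicator_def mult_ac)
  also have "\<dots> = ennreal (fact m / a ^ m)"
    using nn_integral_erlang_ith_moment[OF assms, of 0 m] by simp
  finally have "has_half_line_integral (\<lambda>t. a * (t ^ m * exp (- a * t))) (fact m / a ^ m)"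
    unfolding has_half_line_integral_def using assms
    by (intro has_bochner_integral_nn_integral) (auto simp: indicator_def)
  from has_half_line_integral_cmult[OF this, of "1 / a"] show ?thesis
    by (rule has_half_line_integral_cong) (use assms in auto)
qed

lemma has_half_line_integral_exp:
  assumes "a > 0"
  shows "has_half_line_integral (\<lambda>t. exp (- a * t)) (1 / a)"
  using has_half_line_integral_power_exp[OF assms, of 0] by simp

text \<open>Tonelli's theorem applied to \<open>exp (- u t)\<close> on \<open>{1..x} \<times> {0<..}\<close>.\<close>

lemma frullani:
  assumes "x \<ge> 1"
  shows "has_half_line_integral (\<lambda>t. (exp (- x * t) - exp (- t)) / t) (- ln x)"
proof -
  have nn: "(\<integral>\<^sup>+t. ennreal (exp (- u * t)) * indicator {0<..} t \<partial>lborel) = ennreal (1 / u)" if "u > 0" for u :: real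
  proof -
    have "(\<integral>\<^sup>+t. ennreal (indicator {0<..} t * exp (- u * t)) \<partial>lborel) = ennreal (1 / u)"
      using has_half_line_integral_exp[OF that] unfolding has_half_line_integral_def has_bochner_integral_iff
      by (subst nn_integral_eq_integral) auto
    then show ?thesis
      by (simp add: ennreal_mult' ennreal_indicator mult.commute cong: nn_integral_cong)
  qed
  have inner: "(\<integral>\<^sup>+u. ennreal (exp (- u * t)) * indicator {1..x} u \<partial>lborel)
      = ennreal ((exp (- t) - exp (- x * t)) / t)" if "t > 0" for t
  proof (subst nn_integral_FTC_Icc[where F = "\<lambda>u. - exp (- u * t) / t"])
    show "((\<lambda>u. - exp (- u * t) / t) has_real_derivative exp (- u * t)) (at u)" for u
      using that by (auto intro!: derivative_eq_intros)
  qed (use assms that in \<open>auto simp: diff_divide_distrib\<close>)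
  have "(\<integral>\<^sup>+t. ennreal (indicator {0<..} t * ((exp (- t) - exp (- x * t)) / t)) \<partial>lborel) =
      (\<integral>\<^sup>+t. (\<integral>\<^sup>+u. ennreal (exp (- u * t)) * indicator {1..x} u * indicator {0<..} t \<partial>lborel) \<partial>lborel)"
  proof (intro nn_integral_cong)
    fix t :: real
    show "ennreal (indicator {0<..} t * ((exp (- t) - exp (- x * t)) / t)) =
      (\<integral>\<^sup>+u. ennreal (exp (- u * t)) * indicator {1..x} u * indicator {0<..} t \<partial>lborel)"
      using inner[of t] by (auto simp: indicator_def)
  qed
  also have "\<dots> = (\<integral>\<^sup>+u. (\<integral>\<^sup>+t. ennreal (exp (- u * t)) * indicator {1..x} u * indicator {0<..} t \<partial>lborel) \<partial>lborel)"
    by (intro lborel_pair.Fubini') measurable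
  also have "\<dots> = (\<integral>\<^sup>+u. ennreal (1 / u) * indicator {1..x} u \<partial>lborel)"
  proof (intro nn_integral_cong)
    fix u :: real
    show "(\<integral>\<^sup>+t. ennreal (exp (- u * t)) * indicator {1..x} u * indicator {0<..} t \<partial>lborel)
       = ennreal (1 / u) * indicator {1..x} u"
      using nn[of u] by (auto simp: indicator_def)
  qed
  also have "\<dots> = ennreal (ln x - ln 1)"
  proof (rule nn_integral_FTC_Icc)
    show "(ln has_real_derivative 1 / u) (at u)" if "u \<in> {1..x}" for u
      using that by (auto intro!: derivative_eq_intros)
  qed (use assms in auto)
  finally have "(\<integral>\<^sup>+t. ennreal (indicator {0<..} t * ((exp (- t) - exp (- x * t)) / t)) \<partial>lborel) = ennreal (ln x)"
    by simp
  then have "has_half_line_integral (\<lambda>t. (exp (- t) - exp (- x * t)) / t) (ln x)"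
    unfolding has_half_line_integral_def
    using assms by (intro has_bochner_integral_nn_integral)
      (auto simp: indicator_def)
  from has_half_line_integral_cmult[OF this, of "- 1"] show ?thesis
    by (rule has_half_line_integral_cong) (auto simp: field_simps)
qed

section \<open>Taylor remainders of the exponential function\<close>

definition exp_tail :: "nat \<Rightarrow> real \<Rightarrow> real" where
  "exp_tail p z = exp (- z) - (\<Sum>j<p. (- z) ^ j / fact j)"

lemma exp_tail_0 [simp]: "exp_tail 0 z = exp (- z)"
  by (simp add: exp_tail_def)

lemma exp_tail_at_0 [simp]: "exp_tail (Suc p) 0 = 0"
  by (simp add: exp_tail_def power_0_left if_distrib[of "\<lambda>x. x / _"] lessThan_Suc_eq_insert_0 sum.reindex)

lemma exp_tail_deriv:
  "(exp_tail (Suc p) has_real_derivative - exp_tail p z) (at z)"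
proof -
  have *: "exp_tail (Suc p) = (\<lambda>z. exp (- z) - 1 - (\<Sum>j<p. (- z) ^ Suc j / fact (Suc j)))"
    by (rule ext) (simp add: exp_tail_def sum.lessThan_Suc_shift del: sum.lessThan_Suc)
  have "((\<lambda>z. (- z) ^ Suc j / fact (Suc j)) has_real_derivative - ((- z) ^ j / fact j)) (at z)" for j
    by (auto intro!: derivative_eq_intros simp del: power_Suc of_nat_Suc simp: fact_Suc)
  then have "((\<lambda>z. exp (- z) - 1 - (\<Sum>j<p. (- z) ^ Suc j / fact (Suc j))) has_real_derivative
      - exp (- z) - 0 - (\<Sum>j<p. - ((- z) ^ j / fact j))) (at z)"
    by (intro DERIV_diff DERIV_sum) (auto intro!: derivative_eq_intros)
  then show ?thesis
    unfolding * by (simp add: exp_tail_def sum_negf)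
qed

lemma exp_tail_deriv' [derivative_intros]:
  assumes "(g has_real_derivative g') (at t)"
  shows "((\<lambda>t. exp_tail (Suc p) (g t)) has_real_derivative (- exp_tail p (g t) * g')) (at t)"
  using DERIV_chain2[OF exp_tail_deriv assms] .

text \<open>This combination, at z = x t, is the numerator in the derivative of -
  \<open>exp_tail (Suc p) (x * t)\<close> / t^(p+1); its constant sign permits
  \<open>has_half_line_integral_FTC_nonneg\<close>. It vanishes at 0 and its derivative is minus the
  combination for the preceding p, whence the induction.\<close>

lemma exp_tail_combination_sign:
  assumes "z \<ge> 0"
  shows "0 \<le> (- 1) ^ Suc p * (real (Suc p) * exp_tail (Suc p) z + z * exp_tail p z)"
  using assms
proof (induction p arbitrary: z)
  case 0
  define f where "f = (\<lambda>z::real. (1 + z) * exp (- z))"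
  have "f z \<le> f 0"
    by (rule DERIV_nonpos_imp_nonincreasing[OF 0])
       (auto simp: f_def intro!: derivative_eq_intros exI)
  then show ?case by (simp add: exp_tail_def f_def algebra_simps)
next
  case (Suc p)
  define f where "f = (\<lambda>z. (- 1) ^ Suc (Suc p) * (real (Suc (Suc p)) * exp_tail (Suc (Suc p)) z + z * exp_tail (Suc p) z))"
  have "f 0 \<le> f z"
  proof (rule DERIV_nonneg_imp_nondecreasing[OF Suc.prems])
    fix u :: real assume u: "0 \<le> u" "u \<le> z"
    have "(f has_real_derivative ((- 1) ^ Suc p * (real (Suc p) * exp_tail (Suc p) u + u * exp_tail p u))) (at u)"
      unfolding f_def by (auto intro!: derivative_eq_intros simp: algebra_simps)
    with Suc.IH[OF u(1)] show "\<exists>y. (f has_real_derivative y) (at u) \<and> 0 \<le> y" by blast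
  qed
  then show ?case by (simp add: f_def)
qed

text \<open>By l'Hopital: differentiation lowers the order of numerator and denominator together.
  The limit becomes a boundary term of an integration by parts.\<close>

lemma exp_tail_quotient_at_0:
  "((\<lambda>t. exp_tail p (x * t) / t ^ p) \<longlongrightarrow> (- x) ^ p / fact p) (at_right 0)"
proof (induction p)
  case 0
  show ?case by (auto intro!: tendsto_eq_intros)
next
  case (Suc p)
  show ?case
  proof (rule lhopital_right_0)
    have "isCont (\<lambda>t. exp_tail (Suc p) (x * t)) 0"
      by (rule DERIV_isCont) (auto intro!: derivative_eq_intros)
    then show "((\<lambda>t. exp_tail (Suc p) (x * t)) \<longlongrightarrow> 0) (at_right 0)"
      by (auto simp: isCont_def intro: tendsto_mono[OF at_within_le_at])
    show "((\<lambda>t::real. t ^ Suc p) \<longlongrightarrow> 0) (at_right 0)"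
      by (auto intro!: tendsto_eq_intros)
    show "\<forall>\<^sub>F t in at_right 0. (t::real) ^ Suc p \<noteq> 0"
      "\<forall>\<^sub>F t in at_right 0. real (Suc p) * t ^ p \<noteq> 0"
      by (rule eventually_mono[OF eventually_at_right_less[of 0]], simp)+
    show "\<forall>\<^sub>F t in at_right 0. ((\<lambda>t. exp_tail (Suc p) (x * t)) has_real_derivative - exp_tail p (x * t) * x) (at t)"
      by (auto intro!: always_eventually derivative_eq_intros)
    show "\<forall>\<^sub>F t in at_right 0. ((\<lambda>t. t ^ Suc p) has_real_derivative real (Suc p) * t ^ p) (at t)"
      using DERIV_pow[of "Suc p"] by (intro always_eventually allI) (simp del: power_Suc)
    have "((\<lambda>t. - x / real (Suc p) * (exp_tail p (x * t) / t ^ p)) \<longlongrightarrow> - x / real (Suc p) * ((- x) ^ p / fact p)) (at_right 0)"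
      by (intro tendsto_mult tendsto_const Suc.IH)
    then show "((\<lambda>t. - exp_tail p (x * t) * x / (real (Suc p) * t ^ p)) \<longlongrightarrow> (- x) ^ Suc p / fact (Suc p)) (at_right 0)"
      by (simp add: mult_ac)
  qed
qed

lemma exp_tail_quotient_at_top:
  assumes "x > 0"
  shows "((\<lambda>t. exp_tail p (x * t) / t ^ p) \<longlongrightarrow> 0) at_top"
proof -
  have "((\<lambda>t::real. t ^ j / t ^ p) \<longlongrightarrow> 0) at_top" if "j < p" for j
  proof -
    have "((\<lambda>t::real. inverse (t ^ (p - j))) \<longlongrightarrow> 0) at_top"
      using that by (intro tendsto_inverse_0_at_top filterlim_pow_at_top filterlim_ident) auto
    moreover have "eventually (\<lambda>t::real. inverse (t ^ (p - j)) = t ^ j / t ^ p) at_top"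
      by (rule eventually_mono[OF eventually_gt_at_top[of 0]])
         (use that in \<open>simp add: power_diff field_simps\<close>)
    ultimately show ?thesis by (rule Lim_transform_eventually)
  qed
  then have "((\<lambda>t. exp (- (x * t)) / t ^ p - (\<Sum>j<p. (- x) ^ j / fact j * (t ^ j / t ^ p))) \<longlongrightarrow> 0 - (\<Sum>j<p. (- x) ^ j / fact j * 0)) at_top"
    using assms by (intro tendsto_intros) (real_asymp | auto)+
  moreover have "exp (- (x * t)) / t ^ p - (\<Sum>j<p. (- x) ^ j / fact j * (t ^ j / t ^ p)) = exp_tail p (x * t) / t ^ p" for t
    by (simp add: exp_tail_def diff_divide_distrib sum_divide_distrib mult_ac flip: power_mult_distrib)
  ultimately show ?thesis by simp
qed

text \<open>The Taylor terms of order below p are subtracted outright. The term of order p would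
  then leave a multiple of 1/t, not integrable at infinity, so it is damped by e^(-t), which still
  cancels the singularity at 0.\<close>

definition reg_exp :: "nat \<Rightarrow> real \<Rightarrow> real \<Rightarrow> real" where
  "reg_exp p x t = (exp_tail p (x * t) - (- (x * t)) ^ p / fact p * exp (- t)) / t ^ Suc p"

text \<open>Iterated antiderivatives of ln on the positive axis: the derivative of
  \<open>log_power (Suc p)\<close> is \<open>log_power p\<close>.\<close>

definition log_power :: "nat \<Rightarrow> real \<Rightarrow> real" where
  "log_power p x = x ^ p / fact p * (ln x - harm p)"

text \<open>Induction on p through integration by parts, starting from \<open>frullani\<close>. The
  boundary term at 0 supplies the increment 1/(p+1) from \<open>harm p\<close> to
  \<open>harm (Suc p)\<close>.\<close>

lemma has_half_line_integral_reg_exp: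
  assumes "x \<ge> 1"
  shows "has_half_line_integral (reg_exp p x) (- ((- 1) ^ p * log_power p x))"
proof (induction p)
  case 0
  show ?case using frullani[OF assms]
    by (rule has_half_line_integral_cong) (auto simp: reg_exp_def log_power_def harm_def)
next
  case (Suc p)
  \<comment> \<open>The sign \<open>s\<close> makes the integrand - (s * f) nonnegative; multiplying
    by - s afterwards recovers the integral of \<open>f\<close>.\<close>
  define s where "s = (- 1 :: real) ^ p"
  define f where "f = (\<lambda>t. (real (Suc p) * exp_tail (Suc p) (x * t) + x * t * exp_tail p (x * t)) / t ^ Suc (Suc p))"
  have ss: "s * s = 1" by (simp add: s_def flip: power_add mult_2)
  have "has_half_line_integral (\<lambda>t. - (s * f t)) (s * 0 - s * ((- x) ^ Suc p / fact (Suc p)))"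
  proof (rule has_half_line_integral_FTC_nonneg)
    fix t :: real assume t: "t > 0"
    show "((\<lambda>t. s * (exp_tail (Suc p) (x * t) / t ^ Suc p)) has_real_derivative - (s * f t)) (at t)"
    proof -
      have "((\<lambda>t. exp_tail (Suc p) (x * t)) has_real_derivative - exp_tail p (x * t) * x) (at t)"
        by (auto intro!: derivative_eq_intros)
      moreover have "((\<lambda>t. t ^ Suc p) has_real_derivative real (Suc p) * t ^ p) (at t)"
        using DERIV_pow[of "Suc p" t] by (simp del: power_Suc)
      ultimately have "((\<lambda>t. s * (exp_tail (Suc p) (x * t) / t ^ Suc p)) has_real_derivative
          s * ((- exp_tail p (x * t) * x * t ^ Suc p - exp_tail (Suc p) (x * t) * (real (Suc p) * t ^ p))
            / (t ^ Suc p * t ^ Suc p))) (at t)"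
        using t by (intro DERIV_cmult DERIV_divide) auto
      also have "s * ((- exp_tail p (x * t) * x * t ^ Suc p - exp_tail (Suc p) (x * t) * (real (Suc p) * t ^ p))
            / (t ^ Suc p * t ^ Suc p)) = - (s * f t)"
        using t by (simp add: f_def field_simps)
      finally show ?thesis .
    qed
    have cont: "isCont (\<lambda>t. exp_tail q (x * t)) t" for q
      unfolding exp_tail_def by (intro continuous_intros) auto
    show "isCont (\<lambda>t. - (s * f t)) t"
      using t unfolding f_def by (intro continuous_intros cont) auto
    have "0 \<le> (- 1) ^ Suc p * (real (Suc p) * exp_tail (Suc p) (x * t) + x * t * exp_tail p (x * t)) / t ^ Suc (Suc p)"
      using t assms by (intro divide_nonneg_pos exp_tail_combination_sign) auto
    then show "0 \<le> - (s * f t)" by (simp add: f_def s_def)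
  next
    show "((\<lambda>t. s * (exp_tail (Suc p) (x * t) / t ^ Suc p)) \<longlongrightarrow> s * ((- x) ^ Suc p / fact (Suc p))) (at_right 0)"
      by (intro tendsto_mult tendsto_const exp_tail_quotient_at_0)
    show "((\<lambda>t. s * (exp_tail (Suc p) (x * t) / t ^ Suc p)) \<longlongrightarrow> s * 0) at_top"
      using assms by (intro tendsto_mult tendsto_const exp_tail_quotient_at_top) auto
  qed
  from has_half_line_integral_cmult[OF this, of "- s"]
  have f: "has_half_line_integral f ((- x) ^ Suc p / fact (Suc p))"
    by (rule has_half_line_integral_cong) (simp_all add: ss flip: mult.assoc)
  have "has_half_line_integral (\<lambda>t. 1 / real (Suc p) * (f t - x * reg_exp p x t))
    (1 / real (Suc p) * ((- x) ^ Suc p / fact (Suc p) - x * (- ((- 1) ^ p * log_power p x))))"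
    by (intro has_half_line_integral_cmult has_half_line_integral_diff f Suc.IH)
  then show ?case
  proof (rule has_half_line_integral_cong)
    fix t :: real assume t: "t > 0"
    show "1 / real (Suc p) * (f t - x * reg_exp p x t) = reg_exp (Suc p) x t"
      using t by (simp add: f_def reg_exp_def field_simps del: of_nat_Suc) 
  next
    show "1 / real (Suc p) * ((- x) ^ Suc p / fact (Suc p) - x * - ((- 1) ^ p * log_power p x))
        = - ((- 1) ^ Suc p * log_power (Suc p) x)"
      by (simp add: log_power_def harm_Suc power_minus[of x] field_simps del: of_nat_Suc)
  qed
qed

section \<open>The functional equation and the asymptotics of the remainder\<close>

lemma has_half_line_integral_dominated:
  assumes "f \<in> borel_measurable borel" and "\<And>t. t > 0 \<Longrightarrow> \<bar>f t\<bar> \<le> g t"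
    and "has_half_line_integral g J"
  shows "has_half_line_integral f (LBINT t:{0<..}. f t)" and "\<bar>LBINT t:{0<..}. f t\<bar> \<le> J"
proof -
  have g: "integrable lborel (\<lambda>t. indicator {0<..} t * g t)"
    and J: "(\<integral>t. indicator {0<..} t * g t \<partial>lborel) = J"
    using assms(3) by (auto simp: has_half_line_integral_def has_bochner_integral_iff)
  have le: "norm (indicator {0<..} t * f t) \<le> indicator {0<..} t * g t" for t
    using assms(2)[of t] by (auto simp: indicator_def)
  have [measurable]: "f \<in> borel_measurable borel" by fact
  have "integrable lborel (\<lambda>t. indicator {0<..} t * f t)"
    by (rule Bochner_Integration.integrable_bound[OF g]) (auto intro!: AE_I2 order_trans[OF le, unfolded real_norm_def])
  then show "has_half_line_integral f (LBINT t:{0<..}. f t)"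
    by (simp add: has_half_line_integral_iff set_integrable_def)
  show "\<bar>LBINT t:{0<..}. f t\<bar> \<le> J"
    unfolding J[symmetric] set_lebesgue_integral_def real_scaleR_def real_norm_def[symmetric]
    by (rule Bochner_Integration.integral_norm_bound_integral) (use g le \<open>integrable lborel (\<lambda>t. indicator {0<..} t * f t)\<close> in auto)
qed

text \<open>For N = n + 1 the division by t^N absorbs both factors 1 / t^n and 1 / t of
  \<open>sr_integrand\<close>.\<close>

definition todd_remainder :: "nat \<Rightarrow> real \<Rightarrow> real" where
  "todd_remainder N t = (1 / (1 - exp (- t)) - (\<Sum>i\<le>N. todd i * t ^ i / t)) / t ^ N"

text \<open>For N = 1 this is Binet's first integral, the remainder in Stirling's formula for ln
  Gamma(x).\<close>

definition binet :: "nat \<Rightarrow> real \<Rightarrow> real" where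
  "binet N x = (LBINT t:{0<..}. todd_remainder N t * exp (- x * t))"

lemma todd_remainder_measurable [measurable]: "todd_remainder N \<in> borel_measurable borel"
  unfolding todd_remainder_def[abs_def] by measurable

text \<open>The expansion of 1 / (1 - e^(-t)) to order N + M, divided by t^N. M = 0 gives
  boundedness and hence convergence of \<open>binet\<close>; general M is the input to Watson's
  lemma.\<close>

lemma todd_remainder_bound:
  obtains K where "\<And>t. t > 0 \<Longrightarrow>
    \<bar>todd_remainder N t - (\<Sum>j<M. todd (N + 1 + j) * t ^ j)\<bar> \<le> K * t ^ M"
proof -
  obtain K where K: "\<And>t. t > 0 \<Longrightarrow>
      \<bar>1 / (1 - exp (- t)) - (\<Sum>i\<le>N + M. todd i * t ^ i / t)\<bar> \<le> K * t ^ (N + M)"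
    using todd_expansion_bound[of "N + M"] by blast
  show thesis
  proof (rule that)
    fix t :: real assume t: "t > 0"
    have "(\<Sum>i\<le>N + M. todd i * t ^ i / t) =
        (\<Sum>i\<le>N. todd i * t ^ i / t) + (\<Sum>j<M. todd (N + 1 + j) * t ^ (N + 1 + j) / t)"
    proof (induction M)
      case (Suc M)
      then show ?case by simp
    qed simp
    also have "(\<Sum>j<M. todd (N + 1 + j) * t ^ (N + 1 + j) / t) = (\<Sum>j<M. todd (N + 1 + j) * t ^ j) * t ^ N"
      unfolding sum_distrib_right using t by (intro sum.cong) (simp_all add: power_add)
    finally have "todd_remainder N t - (\<Sum>j<M. todd (N + 1 + j) * t ^ j) =
        (1 / (1 - exp (- t)) - (\<Sum>i\<le>N + M. todd i * t ^ i / t)) / t ^ N"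
      using t by (simp add: todd_remainder_def field_simps)
    then show "\<bar>todd_remainder N t - (\<Sum>j<M. todd (N + 1 + j) * t ^ j)\<bar> \<le> K * t ^ M"
      using K[OF t] t by (simp add: abs_divide divide_le_eq power_add mult_ac)
  qed
qed

lemma has_half_line_integral_binet:
  assumes "x > 0"
  shows "has_half_line_integral (\<lambda>t. todd_remainder N t * exp (- x * t)) (binet N x)"
proof -
  obtain K where K: "\<And>t. t > 0 \<Longrightarrow> \<bar>todd_remainder N t\<bar> \<le> K"
    using todd_remainder_bound[of N 0] by auto
  show ?thesis
    unfolding binet_def
    by (rule has_half_line_integral_dominated(1)[OF _ _
          has_half_line_integral_cmult[OF has_half_line_integral_exp[OF assms], of K]])
       (auto simp: abs_mult intro!: mult_right_mono K)
qed

text \<open>Watson's lemma: the Taylor polynomial integrates term by term against e^(-x t), and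
  since the bound on the rest holds for all t > 0, no splitting of the integral is needed.\<close>

lemma binet_asymptotics:
  obtains K where "\<And>x. x > 0 \<Longrightarrow>
    \<bar>binet N x - (\<Sum>j<M. todd (N + 1 + j) * (fact j / x ^ Suc j))\<bar> \<le> K / x ^ Suc M"
proof -
  obtain K where K: "\<And>t. t > 0 \<Longrightarrow>
      \<bar>todd_remainder N t - (\<Sum>j<M. todd (N + 1 + j) * t ^ j)\<bar> \<le> K * t ^ M"
    using todd_remainder_bound[of N M] by blast
  show thesis
  proof (rule that)
    fix x :: real assume x: "x > 0"
    define f where "f = (\<lambda>t. (todd_remainder N t - (\<Sum>j<M. todd (N + 1 + j) * t ^ j)) * exp (- x * t))"
    have "has_half_line_integral (\<lambda>t. todd_remainder N t * exp (- x * t) -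
        (\<Sum>j<M. todd (N + 1 + j) * (t ^ j * exp (- x * t))))
        (binet N x - (\<Sum>j<M. todd (N + 1 + j) * (fact j / x ^ Suc j)))"
      by (intro has_half_line_integral_diff has_half_line_integral_binet has_half_line_integral_sum
          has_half_line_integral_cmult has_half_line_integral_power_exp x)
    then have f: "has_half_line_integral f (binet N x - (\<Sum>j<M. todd (N + 1 + j) * (fact j / x ^ Suc j)))"
      by (rule has_half_line_integral_cong) (auto simp: f_def left_diff_distrib sum_distrib_right mult.assoc)
    have "\<bar>LBINT t:{0<..}. f t\<bar> \<le> K * (fact M / x ^ Suc M)"
    proof (rule has_half_line_integral_dominated(2))
      show "f \<in> borel_measurable borel" unfolding f_def by measurable
      show "\<bar>f t\<bar> \<le> K * (t ^ M * exp (- x * t))" if "t > 0" for t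
        using mult_right_mono[OF K[OF that], of "exp (- x * t)"] by (simp add: f_def abs_mult mult_ac)
      show "has_half_line_integral (\<lambda>t. K * (t ^ M * exp (- x * t))) (K * (fact M / x ^ Suc M))"
        by (intro has_half_line_integral_cmult has_half_line_integral_power_exp x)
    qed
    then show "\<bar>binet N x - (\<Sum>j<M. todd (N + 1 + j) * (fact j / x ^ Suc j))\<bar> \<le> K * fact M / x ^ Suc M"
      using f by (simp add: has_half_line_integral_iff)
  qed
qed

text \<open>
  The Taylor parts subtracted in \<open>reg_exp\<close> cancel since \<open>1 - (1 - e^(-t)) \<Sum>\<^sub>i\<^sub>\<le>\<^sub>N todd i t^(i-1)\<close>
  vanishes to order \<open>N\<close> at \<open>t = 0\<close>.
\<close>

lemma todd_remainder_difference:
  assumes t: "t > 0" and N: "N = Suc n"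
  shows "todd_remainder N t * exp (- x * t) - todd_remainder N t * exp (- (x + 1) * t) =
    reg_exp n x t - (\<Sum>i\<le>N. todd i * (reg_exp (N - i) x t - reg_exp (N - i) (x + 1) t))"
proof -
  \<comment> \<open>In the product of t^i with the part subtracted in
    \<open>reg_exp (N - i)\<close>, the damped term always has total degree N. So the damping
    depends only on the total degree, and \<open>w\<close> records it; the shift N - p in
    \<open>q\<close> converts the order j to that degree.\<close>
  define w where "w = (\<lambda>m. if m < N then 1 else exp (- t))"
  define q where "q = (\<lambda>p y. \<Sum>j\<le>p. (- (y * t)) ^ j / fact j * w (N - p + j))"
  have reg: "reg_exp p y t = (exp (- y * t) - q p y) / t ^ Suc p" if "p \<le> N" for p y
  proof -
    have "(\<Sum>j<p. (- (y * t)) ^ j / fact j * w (N - p + j)) = (\<Sum>j<p. (- (y * t)) ^ j / fact j)"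
      using that by (intro sum.cong) (auto simp: w_def)
    then have "q p y = (\<Sum>j<p. (- (y * t)) ^ j / fact j) + (- (y * t)) ^ p / fact p * exp (- t)"
      using that unfolding q_def lessThan_Suc_atMost[symmetric] by (simp add: w_def)
    then show ?thesis by (simp add: reg_exp_def exp_tail_def)
  qed
  have "(\<Sum>i\<le>N. todd i * t ^ i * (q (N - i) x - q (N - i) (x + 1))) =
      (\<Sum>i\<le>N. \<Sum>j\<le>N - i. t ^ (i + j) * w (i + j) * (todd i * (((- x) ^ j - (- x - 1) ^ j) / fact j)))"
  proof (rule sum.cong)
    fix i assume i: "i \<in> {..N}"
    have "(- (x * t)) ^ j = (- x) ^ j * t ^ j" "(- ((x + 1) * t)) ^ j = (- x - 1) ^ j * t ^ j" for j
      unfolding power_mult_distrib[symmetric] by (simp_all add: left_diff_distrib distrib_right)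
    then show "todd i * t ^ i * (q (N - i) x - q (N - i) (x + 1)) =
        (\<Sum>j\<le>N - i. t ^ (i + j) * w (i + j) * (todd i * (((- x) ^ j - (- x - 1) ^ j) / fact j)))"
      using i by (simp add: q_def sum_distrib_left diff_divide_distrib power_add algebra_simps
          flip: sum_subtractf)
  qed simp
  \<comment> \<open>Collecting by total degree m = i + j pulls the weight out, and
    \<open>todd_difference\<close> applies in each degree. Degree 0 contributes a difference of
    constants, that is 0.\<close>
  also have "\<dots> = (\<Sum>m\<le>N. \<Sum>i\<le>m. t ^ m * w m * (todd i * (((- x) ^ (m - i) - (- x - 1) ^ (m - i)) / fact (m - i))))"
  proof -
    have "{(i, j). i + j \<le> N} = Sigma {..N} (\<lambda>i. {..N - i})" by auto
    then have "(\<Sum>i\<le>N. \<Sum>j\<le>N - i. g i j) = (\<Sum>m\<le>N. \<Sum>i\<le>m. g i (m - i))" for g :: "nat \<Rightarrow> nat \<Rightarrow> real"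
      using sum.triangle_reindex_eq[of g N] by (simp add: sum.Sigma)
    then show ?thesis by simp
  qed
  also have "\<dots> = (\<Sum>m\<le>n. t ^ Suc m * w (Suc m) *
     (\<Sum>i\<le>Suc m. todd i * (((- x) ^ (Suc m - i) - (- x - 1) ^ (Suc m - i)) / fact (Suc m - i))))"
    unfolding N sum.atMost_Suc_shift[of _ n] by (simp add: sum_distrib_left del: sum.atMost_Suc)
  also have "\<dots> = (\<Sum>m\<le>n. t ^ Suc m * w (Suc m) * ((- x) ^ m / fact m))"
    unfolding todd_difference ..
  also have "\<dots> = t * q n x"
    unfolding q_def sum_distrib_left by (intro sum.cong) (auto simp: N power_mult_distrib[of "- x" t, simplified])
  finally have cancel: "(\<Sum>i\<le>N. todd i * t ^ i * (q (N - i) x - q (N - i) (x + 1))) = t * q n x" .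

  have summand: "todd i * (reg_exp (N - i) x t - reg_exp (N - i) (x + 1) t) =
      (todd i * t ^ i / t * (exp (- x * t) - exp (- (x + 1) * t))
        - todd i * t ^ i * (q (N - i) x - q (N - i) (x + 1)) / t) / t ^ N" if "i \<le> N" for i
  proof -
    have "t ^ N = t ^ i * t ^ (N - i)" using that by (simp flip: power_add)
    then show ?thesis using t by (simp add: reg field_simps)
  qed
  have "(\<Sum>i\<le>N. todd i * (reg_exp (N - i) x t - reg_exp (N - i) (x + 1) t)) =
      ((\<Sum>i\<le>N. todd i * t ^ i / t) * (exp (- x * t) - exp (- (x + 1) * t)) - q n x) / t ^ N"
    using t cancel by (simp add: summand sum_subtractf sum_distrib_right flip: sum_divide_distrib)
  moreover have "todd_remainder N t * exp (- x * t) - todd_remainder N t * exp (- (x + 1) * t) =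
     (exp (- x * t) - (\<Sum>i\<le>N. todd i * t ^ i / t) * (exp (- x * t) - exp (- (x + 1) * t))) / t ^ N"
  proof -
    have ring: "(a - b) / c * d - (a - b) / c * e = (a * (d - e) - b * (d - e)) / c" for a b c d e :: real
      by (simp add: algebra_simps diff_divide_distrib add_divide_distrib)
    have "exp (- (x + 1) * t) = exp (- x * t) * exp (- t)" by (simp add: algebra_simps flip: exp_add)
    then have "1 / (1 - exp (- t)) * (exp (- x * t) - exp (- (x + 1) * t)) = exp (- x * t)"
      using t by (simp add: field_simps)
    then show ?thesis unfolding todd_remainder_def ring by simp
  qed
  ultimately show ?thesis by (simp add: reg N diff_divide_distrib del: sum.atMost_Suc power_Suc)
qed

text \<open>Both sides of \<open>todd_remainder_difference\<close> are integrated, the right one by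
  \<open>has_half_line_integral_reg_exp\<close>; uniqueness of the integral gives the equation, and
  the factor (-1)^n clears the signs.\<close>

lemma binet_difference:
  assumes "x \<ge> 1"
  shows "(- 1) ^ n * (binet (Suc n) (x + 1) - binet (Suc n) x) = log_power n x -
    (\<Sum>i\<le>Suc n. (- 1) ^ i * todd i * (log_power (Suc n - i) (x + 1) - log_power (Suc n - i) x))"
proof -
  let ?N = "Suc n"
  let ?L = "\<lambda>p x. - ((- 1) ^ p * log_power p x)"
  have "has_half_line_integral (\<lambda>t. todd_remainder ?N t * exp (- x * t) - todd_remainder ?N t * exp (- (x + 1) * t))
      (binet ?N x - binet ?N (x + 1))"
    using assms by (intro has_half_line_integral_diff has_half_line_integral_binet) auto
  then have "has_half_line_integral
      (\<lambda>t. reg_exp n x t - (\<Sum>i\<le>?N. todd i * (reg_exp (?N - i) x t - reg_exp (?N - i) (x + 1) t)))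
      (binet ?N x - binet ?N (x + 1))"
    by (rule has_half_line_integral_cong[OF _ todd_remainder_difference[OF _ refl] refl])
  moreover have "has_half_line_integral
      (\<lambda>t. reg_exp n x t - (\<Sum>i\<le>?N. todd i * (reg_exp (?N - i) x t - reg_exp (?N - i) (x + 1) t)))
      (?L n x - (\<Sum>i\<le>?N. todd i * (?L (?N - i) x - ?L (?N - i) (x + 1))))"
    using assms by (intro has_half_line_integral_diff has_half_line_integral_sum
        has_half_line_integral_cmult has_half_line_integral_reg_exp) auto
  ultimately have "binet ?N x - binet ?N (x + 1) =
      ?L n x - (\<Sum>i\<le>?N. todd i * (?L (?N - i) x - ?L (?N - i) (x + 1)))"
    by (rule has_half_line_integral_unique)
  then have "(- 1) ^ n * (binet ?N (x + 1) - binet ?N x) =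
     (- 1) ^ n * ((- 1) ^ n * log_power n x) + (\<Sum>i\<le>?N. (- 1) ^ n * (todd i * (?L (?N - i) x - ?L (?N - i) (x + 1))))"
    unfolding sum_distrib_left[symmetric] distrib_left[symmetric] by simp
  also have "(\<Sum>i\<le>?N. (- 1) ^ n * (todd i * (?L (?N - i) x - ?L (?N - i) (x + 1)))) =
     (\<Sum>i\<le>?N. - ((- 1) ^ i * todd i * (log_power (?N - i) (x + 1) - log_power (?N - i) x)))"
  proof (rule sum.cong)
    fix i assume i: "i \<in> {..?N}"
    have "(- 1) ^ n * (- 1) ^ (?N - i) = - ((- 1 :: real) ^ i)"
      using i by (auto simp: minus_one_power_iff)
    moreover have "(- 1) ^ n * (todd i * (?L (?N - i) x - ?L (?N - i) (x + 1))) =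
        ((- 1) ^ n * (- 1) ^ (?N - i)) * todd i * (log_power (?N - i) (x + 1) - log_power (?N - i) x)"
      by (simp only: ring_distribs mult_ac minus_mult_left minus_mult_right)
    ultimately show "(- 1) ^ n * (todd i * (?L (?N - i) x - ?L (?N - i) (x + 1))) =
      - ((- 1) ^ i * todd i * (log_power (?N - i) (x + 1) - log_power (?N - i) x))"
      by (simp only: minus_mult_left)
  qed simp
  finally show ?thesis by (simp add: sum_negf flip: mult.assoc del: sum.atMost_Suc)
qed

section \<open>Summation of k^n ln k by telescoping\<close>

definition log_potential :: "nat \<Rightarrow> real \<Rightarrow> real" where
  "log_potential n x = fact n * ((\<Sum>i\<le>Suc n. (- 1) ^ i * todd i * (x ^ (Suc n - i) / fact (Suc n - i) *
      (ln x - harm (Suc n - i) + harm n))) + (- 1) ^ n * binet (Suc n) x)"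

text \<open>\<open>binet_difference\<close> alone produces ln x - \<open>harm n\<close>. The summand
  \<open>harm n\<close> in \<open>log_potential\<close> adds that multiple of a Bernoulli
  polynomial, whose difference x^n / n! cancels the harmonic number.\<close>

lemma log_potential_difference:
  assumes "x \<ge> 1"
  shows "log_potential n (x + 1) - log_potential n x = x ^ n * ln x"
proof -
  have *: "(\<Sum>i\<le>Suc n. (- 1) ^ i * todd i * (y ^ (Suc n - i) / fact (Suc n - i) *
      (ln y - harm (Suc n - i) + harm n))) =
      (\<Sum>i\<le>Suc n. (- 1) ^ i * todd i * log_power (Suc n - i) y) +
      harm n * (\<Sum>i\<le>Suc n. (- 1) ^ i * todd i * (y ^ (Suc n - i) / fact (Suc n - i)))" for y
    unfolding sum_distrib_left sum.distrib[symmetric]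
    by (intro sum.cong refl) (simp add: log_power_def ring_distribs)
  have "(\<Sum>i\<le>Suc n. (- 1) ^ i * todd i * ((x + 1) ^ (Suc n - i) / fact (Suc n - i)))
      - (\<Sum>i\<le>Suc n. (- 1) ^ i * todd i * (x ^ (Suc n - i) / fact (Suc n - i))) = x ^ n / fact n"
    unfolding todd_difference_signed[where m = n and x = x, symmetric] sum_subtractf[symmetric]
    by (intro sum.cong refl) (simp add: diff_divide_distrib right_diff_distrib)
  then have "log_potential n (x + 1) - log_potential n x = fact n *
     ((\<Sum>i\<le>Suc n. (- 1) ^ i * todd i * (log_power (Suc n - i) (x + 1) - log_power (Suc n - i) x))
      + harm n * (x ^ n / fact n) + (- 1) ^ n * (binet (Suc n) (x + 1) - binet (Suc n) x))"
    unfolding log_potential_def * by (simp add: algebra_simps sum_subtractf del: sum.atMost_Suc)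
  also have "\<dots> = x ^ n * ln x"
    unfolding binet_difference[OF assms] by (simp add: log_power_def field_simps del: sum.atMost_Suc)
  finally show ?thesis .
qed

lemma sum_power_times_ln:
  assumes "s \<ge> 1"
  shows "(\<Sum>k=1..s. real k ^ n * ln (real k)) =
    real s ^ n * ln (real s) + log_potential n (real s) - log_potential n 1"
  using assms
proof (induction s rule: dec_induct)
  case (step s)
  then show ?case
    using log_potential_difference[of "real s" n] by (simp add: add.commute)
qed simp

section \<open>The Stirling-Ramanujan constants\<close>

lemma power_quotient_tendsto_0:
  assumes "j < M"
  shows "(\<lambda>s. real s ^ j / real s ^ M) \<longlonglongrightarrow> 0"
    and "(\<lambda>s. real s ^ j * ln (real s) / real s ^ M) \<longlonglongrightarrow> 0"
proof -
  have eq: "eventually (\<lambda>s. 1 / real s ^ (M - j) = real s ^ j / real s ^ M) sequentially"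
    by (rule eventually_mono[OF eventually_gt_at_top[of 0]])
       (use assms in \<open>simp add: power_diff\<close>)
  have "(\<lambda>s. 1 / real s ^ (M - j)) \<longlonglongrightarrow> 0"
    using assms by real_asymp
  then show "(\<lambda>s. real s ^ j / real s ^ M) \<longlonglongrightarrow> 0"
    by (rule Lim_transform_eventually[OF _ eq])
  have "(\<lambda>s. 1 / real s ^ (M - j) * ln (real s)) \<longlonglongrightarrow> 0"
    using assms by real_asymp
  then show "(\<lambda>s. real s ^ j * ln (real s) / real s ^ M) \<longlonglongrightarrow> 0"
    by (rule Lim_transform_eventually) (rule eventually_mono[OF eq], simp)
qed

text \<open>After division by the highest power only a ln s + b survives. Its convergence to 0
  forces a = 0, on dividing by ln s, and then b = 0, so the degree drops by one.\<close>

lemma log_polynomial_tendsto_0D: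
  fixes a b :: "nat \<Rightarrow> real"
  assumes "(\<lambda>s. (\<Sum>j\<le>M. a j * real s ^ j) * ln (real s) + (\<Sum>j\<le>M. b j * real s ^ j)) \<longlonglongrightarrow> 0"
  shows "b 0 = 0"
  using assms
proof (induction M)
  case 0
  then have lim: "(\<lambda>s. a 0 * ln (real s) + b 0) \<longlonglongrightarrow> 0" by simp
  have "(\<lambda>s. (a 0 * ln (real s) + b 0) * (1 / ln (real s))) \<longlonglongrightarrow> 0 * 0"
    by (intro tendsto_mult lim) real_asymp
  moreover have "(\<lambda>s. (a 0 * ln (real s) + b 0) * (1 / ln (real s))) \<longlonglongrightarrow> a 0"
    by real_asymp
  ultimately have "a 0 = 0" using LIMSEQ_unique by fastforce
  with lim show ?case by (simp add: LIMSEQ_const_iff)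
next
  case (Suc M)
  define F where "F = (\<lambda>s. (\<Sum>j\<le>Suc M. a j * real s ^ j) * ln (real s) + (\<Sum>j\<le>Suc M. b j * real s ^ j))"
  have F: "F \<longlonglongrightarrow> 0" using Suc.prems by (simp add: F_def)
  let ?N = "Suc M"
  define L where "L = (\<lambda>s. (\<Sum>j\<le>M. a j * (real s ^ j * ln (real s) / real s ^ ?N)) + (\<Sum>j\<le>M. b j * (real s ^ j / real s ^ ?N)))"
  have "L \<longlonglongrightarrow> (\<Sum>j\<le>M. a j * 0) + (\<Sum>j\<le>M. b j * 0)"
    unfolding L_def by (intro tendsto_add tendsto_sum tendsto_mult tendsto_const power_quotient_tendsto_0) auto
  then have L: "L \<longlonglongrightarrow> 0" by simp
  have "eventually (\<lambda>s. F s * (1 / real s ^ ?N) - L s = a ?N * ln (real s) + b ?N) sequentially"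
  proof (rule eventually_mono[OF eventually_gt_at_top[of 0]])
    fix s :: nat assume s: "s > 0"
    have "F s = (\<Sum>j\<le>M. a j * (real s ^ j * ln (real s))) + (\<Sum>j\<le>M. b j * real s ^ j)
        + real s ^ ?N * (a ?N * ln (real s) + b ?N)"
      by (simp add: F_def algebra_simps sum_distrib_left)
    moreover have "L s = ((\<Sum>j\<le>M. a j * (real s ^ j * ln (real s))) + (\<Sum>j\<le>M. b j * real s ^ j)) / real s ^ ?N"
      by (simp add: L_def sum_divide_distrib add_divide_distrib del: power_Suc)
    ultimately show "F s * (1 / real s ^ ?N) - L s = a ?N * ln (real s) + b ?N"
      using s by (simp add: add_divide_distrib del: power_Suc)
  qed
  moreover have "(\<lambda>s. F s * (1 / real s ^ ?N) - L s) \<longlonglongrightarrow> 0 * 0 - 0"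
    by (intro tendsto_diff tendsto_mult F L) real_asymp
  ultimately have lim: "(\<lambda>s. a ?N * ln (real s) + b ?N) \<longlonglongrightarrow> 0"
    by (auto elim: Lim_transform_eventually)
  have "(\<lambda>s. (a ?N * ln (real s) + b ?N) * (1 / ln (real s))) \<longlonglongrightarrow> 0 * 0"
    by (intro tendsto_mult lim) real_asymp
  moreover have "(\<lambda>s. (a ?N * ln (real s) + b ?N) * (1 / ln (real s))) \<longlonglongrightarrow> a ?N"
    by real_asymp
  ultimately have a: "a ?N = 0" using LIMSEQ_unique by fastforce
  with lim have "b ?N = 0" by (simp add: LIMSEQ_const_iff)
  with a Suc.prems have "(\<lambda>s. (\<Sum>j\<le>M. a j * real s ^ j) * ln (real s) + (\<Sum>j\<le>M. b j * real s ^ j)) \<longlonglongrightarrow> 0"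
    by simp
  then show ?case by (rule Suc.IH)
qed

lemma poly_altdef_le:
  fixes p :: "real poly"
  assumes "degree p \<le> M"
  shows "poly p x = (\<Sum>j\<le>M. poly.coeff p j * x ^ j)"
  unfolding poly_altdef using assms by (intro sum.mono_neutral_left) (auto simp: coeff_eq_0)

lemma stirling_ramanujan_expansion_unique:
  assumes "stirling_ramanujan_expansion n A B S R" "stirling_ramanujan_expansion n A' B' S' R'"
  shows "S = S'"
proof -
  \<comment> \<open>Truncation at order 0 suffices: as \<open>fps_nth R 0 = 0\<close>, the series
    contributes nothing and the error is O(1/s).\<close>
  have *: "(\<lambda>s. (\<Sum>k=1..s. real k ^ n * ln (real k)) - (poly (map_poly of_rat A) (real s) * ln (real s)
        + poly (map_poly of_rat B) (real s) + S)) \<longlonglongrightarrow> 0"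
    if "stirling_ramanujan_expansion n A B S R" for A B S R
  proof -
    have "(\<lambda>s. (\<Sum>k=1..s. real k ^ n * ln (real k)) - (poly (map_poly of_rat A) (real s) * ln (real s)
        + poly (map_poly of_rat B) (real s) + S)) \<in> O(\<lambda>s. 1 / real s)"
      using that unfolding stirling_ramanujan_expansion_def by (auto dest!: spec[of _ 0])
    moreover have "(\<lambda>s. 1 / real s) \<in> o(\<lambda>_. 1)" by real_asymp
    ultimately have "(\<lambda>s. (\<Sum>k=1..s. real k ^ n * ln (real k)) - (poly (map_poly of_rat A) (real s) * ln (real s)
        + poly (map_poly of_rat B) (real s) + S)) \<in> o(\<lambda>_. 1)"
      by (rule landau_o.big_small_trans)
    then show ?thesis by (auto dest: smalloD_tendsto)
  qed
  define P :: "real poly" where "P = map_poly of_rat A' - map_poly of_rat A"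
  \<comment> \<open>Neither \<open>B\<close> nor \<open>B'\<close> has a constant term, so the
    constant coefficient of \<open>Q\<close> is S' - S.\<close>
  define Q :: "real poly" where "Q = map_poly of_rat B' - map_poly of_rat B + [:S' - S:]"
  define M where "M = max (degree P) (degree Q)"
  have "(\<lambda>s. poly P (real s) * ln (real s) + poly Q (real s)) \<longlonglongrightarrow> 0"
    using tendsto_diff[OF *[OF assms(1)] *[OF assms(2)]]
    by (simp add: P_def Q_def algebra_simps)
  then have "poly.coeff Q 0 = 0"
    by (intro log_polynomial_tendsto_0D[of "poly.coeff P" M])
       (simp add: poly_altdef_le[of P M] poly_altdef_le[of Q M] M_def)
  moreover have "poly.coeff B 0 = 0" "poly.coeff B' 0 = 0"
    using assms by (auto simp: stirling_ramanujan_expansion_def)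
  ultimately show ?thesis by (simp add: Q_def coeff_map_poly)
qed

section \<open>Existence of the expansion\<close>

lemma poly_map_of_rat_sum_monom:
  "poly (map_poly of_rat (\<Sum>i\<in>I. monom (a i) (e i))) (x::real) = (\<Sum>i\<in>I. of_rat (a i) * x ^ e i)"
proof -
  have "map_poly (of_rat :: rat \<Rightarrow> real) (\<Sum>i\<in>I. monom (a i) (e i)) = (\<Sum>i\<in>I. monom (of_rat (a i)) (e i))"
    by (intro poly_eqI) (auto simp: coeff_map_poly coeff_sum of_rat_sum intro!: sum.cong)
  then show ?thesis by (simp add: poly_sum poly_monom)
qed

lemma poly_map_of_rat_add:
  "poly (map_poly of_rat (p + q)) (x::real) = poly (map_poly of_rat p) x + poly (map_poly of_rat q) x"
proof -
  have "map_poly (of_rat :: rat \<Rightarrow> real) (p + q) = map_poly of_rat p + map_poly of_rat q"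
    by (intro poly_eqI) (auto simp: coeff_map_poly of_rat_add)
  then show ?thesis by simp
qed

lemma harm_conv_of_rat: "harm p = (of_rat (\<Sum>k=1..p. 1 / of_nat k) :: real)"
  by (simp add: harm_def of_rat_sum of_rat_divide inverse_eq_divide)

text \<open>By \<open>sum_power_times_ln\<close> it remains to sort the terms of
  \<open>log_potential\<close> at s. Its summand i = Suc n has degree 0: the logarithm goes to
  \<open>A\<close>, while the leftover multiple of \<open>harm n\<close> (as
  \<open>harm 0 = 0\<close>) must go to the constant because \<open>B\<close> has no constant
  term.\<close>

lemma stirling_ramanujan_expansion_exists:
  "\<exists>A B R. stirling_ramanujan_expansion n A B
     (fact n * ((- 1) ^ Suc n * todd (Suc n) * harm n) - log_potential n 1) R"
proof -
  let ?N = "Suc n"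
  define h :: "nat \<Rightarrow> rat" where "h = (\<lambda>p. \<Sum>k=1..p. 1 / of_nat k)"
  define c where "c = (\<lambda>i. todd_coeff (int i - 1))"
  define co where "co = (\<lambda>i. fact n * ((- 1) ^ i * c i / fact (?N - i)))"
  \<comment> \<open>The extra monomial is the last summand s^n ln s, which the telescoping leaves
    over.\<close>
  define A where "A = monom 1 n + (\<Sum>i\<le>?N. monom (co i) (?N - i))"
  define B where "B = (\<Sum>i\<le>n. monom (co i * (h n - h (?N - i))) (?N - i))"
  \<comment> \<open>The Watson coefficients of \<open>binet\<close>, shifted by one: the term
    \<open>fact j / x ^ Suc j\<close> belongs to index j + 1.\<close>
  define R where "R = Abs_fps (\<lambda>j. if j = 0 then 0 else fact n * (- 1) ^ n * c (?N + j) * fact (j - 1))"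
  have h: "of_rat (h p) = (harm p :: real)" for p unfolding h_def harm_conv_of_rat ..
  have co: "of_rat (co i) = fact n * ((- 1) ^ i * todd i / fact (?N - i))" for i
    by (simp add: co_def c_def todd_def of_rat_mult of_rat_divide of_rat_power of_rat_minus of_rat_fact del: fact_Suc)
  have A: "poly (map_poly of_rat A) x = x ^ n + (\<Sum>i\<le>?N. of_rat (co i) * x ^ (?N - i))" for x :: real
    unfolding A_def poly_map_of_rat_add poly_map_of_rat_sum_monom by (simp add: map_poly_monom poly_monom)
  have B: "poly (map_poly of_rat B) x = (\<Sum>i\<le>n. of_rat (co i) * (harm n - harm (?N - i)) * x ^ (?N - i))" for x :: real
    unfolding B_def poly_map_of_rat_sum_monom by (simp add: of_rat_mult of_rat_diff h)
  define S where "S = fact n * ((- 1) ^ ?N * todd ?N * harm n) - log_potential n 1"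
  have expand: "(\<Sum>k=1..s. real k ^ n * ln (real k)) - (poly (map_poly of_rat A) (real s) * ln (real s)
        + poly (map_poly of_rat B) (real s) + S) = fact n * (- 1) ^ n * binet ?N (real s)" if "s \<ge> 1" for s
  proof -
    have "fact n * (\<Sum>i\<le>?N. (- 1) ^ i * todd i * (real s ^ (?N - i) / fact (?N - i) *
        (ln (real s) - harm (?N - i) + harm n)))
       = (\<Sum>i\<le>?N. of_rat (co i) * real s ^ (?N - i)) * ln (real s)
        + (\<Sum>i\<le>?N. of_rat (co i) * (harm n - harm (?N - i)) * real s ^ (?N - i))"
      unfolding sum_distrib_left sum_distrib_right sum.distrib[symmetric]
      by (intro sum.cong) (auto simp: co algebra_simps diff_divide_distrib add_divide_distrib)
    also have "(\<Sum>i\<le>?N. of_rat (co i) * (harm n - harm (?N - i)) * real s ^ (?N - i)) =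
        poly (map_poly of_rat B) (real s) + fact n * ((- 1) ^ ?N * todd ?N * harm n)"
      by (simp add: B co harm_def)
    finally show ?thesis
      unfolding sum_power_times_ln[OF that] A S_def log_potential_def[of n "real s"]
      by (simp add: algebra_simps del: sum.atMost_Suc)
  qed
  have "stirling_ramanujan_expansion n A B S R"
    unfolding stirling_ramanujan_expansion_def
  proof (intro conjI allI)
    show "poly.coeff B 0 = 0" by (simp add: B_def coeff_sum)
    show "fps_nth R 0 = 0" by (simp add: R_def)
  next
    fix M
    obtain K where K: "\<And>x. x > 0 \<Longrightarrow>
        \<bar>binet ?N x - (\<Sum>j<M. todd (?N + 1 + j) * (fact j / x ^ Suc j))\<bar> \<le> K / x ^ Suc M"
      using binet_asymptotics[of ?N M] by blast
    have tail: "(\<Sum>j\<le>M. of_rat (fps_nth R j) * (1 / x) ^ j) =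
        fact n * (- 1) ^ n * (\<Sum>j<M. todd (?N + 1 + j) * (fact j / x ^ Suc j))" for x :: real
    proof -
      have "(\<Sum>j\<le>M. of_rat (fps_nth R j) * (1 / x) ^ j) = (\<Sum>j<M. of_rat (fps_nth R (Suc j)) * (1 / x) ^ Suc j)"
        unfolding lessThan_Suc_atMost[symmetric] sum.lessThan_Suc_shift by (simp add: R_def)
      also have "\<dots> = fact n * (- 1) ^ n * (\<Sum>j<M. todd (?N + 1 + j) * (fact j / x ^ Suc j))"
        unfolding sum_distrib_left
        by (intro sum.cong) (auto simp: R_def c_def todd_def of_rat_mult of_rat_power of_rat_minus
            of_rat_fact power_divide)
      finally show ?thesis .
    qed
    show "(\<lambda>s. (\<Sum>k=1..s. real k ^ n * ln (real k)) - (poly (map_poly of_rat A) (real s) * ln (real s)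
        + poly (map_poly of_rat B) (real s) + S + (\<Sum>j\<le>M. of_rat (fps_nth R j) * (1 / real s) ^ j)))
        \<in> O(\<lambda>s. (1 / real s) ^ (M + 1))"
    proof (rule bigoI[of _ "fact n * K"], rule eventually_mono[OF eventually_ge_at_top[of 1]])
      fix s :: nat assume s: "s \<ge> 1"
      have "(\<Sum>k=1..s. real k ^ n * ln (real k)) - (poly (map_poly of_rat A) (real s) * ln (real s)
        + poly (map_poly of_rat B) (real s) + S + (\<Sum>j\<le>M. of_rat (fps_nth R j) * (1 / real s) ^ j)) =
        fact n * (- 1) ^ n * (binet ?N (real s) - (\<Sum>j<M. todd (?N + 1 + j) * (fact j / real s ^ Suc j)))"
        unfolding right_diff_distrib expand[OF s, symmetric] tail by simp
      then show "norm ((\<Sum>k=1..s. real k ^ n * ln (real k)) - (poly (map_poly of_rat A) (real s) * ln (real s)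
        + poly (map_poly of_rat B) (real s) + S + (\<Sum>j\<le>M. of_rat (fps_nth R j) * (1 / real s) ^ j)))
         \<le> fact n * K * norm ((1 / real s) ^ (M + 1))"
        using mult_left_mono[OF K[of "real s"], of "fact n"] s
        by (simp add: abs_mult power_abs power_divide del: sum.lessThan_Suc)
    qed
  qed
  then show ?thesis unfolding S_def by blast
qed

section \<open>The integral formula\<close>

theorem theorem1:
  fixes n :: nat
  shows "r_coeff n \<in> \<rat>
    \<and> set_integrable lborel {0<..} (sr_integrand n)
    \<and> stirling_ramanujan n =
        (- 1) ^ (n + 1) * fact n * (LBINT t:{0<..}. sr_integrand n t)"
proof -
  let ?N = "Suc n"
  have rat: "r_coeff n \<in> \<rat>"
  proof -
    have "(harm k :: real) \<in> \<rat>" for k unfolding harm_conv_of_rat by (rule Rats_of_rat)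
    moreover have "(fact k :: real) \<in> \<rat>" for k by (metis Rats_of_nat of_nat_fact)
    ultimately show ?thesis unfolding r_coeff_def
      by (intro Rats_sum Rats_mult Rats_divide Rats_power Rats_of_rat Rats_minus_iff[THEN iffD2] Rats_1)
  qed
  have r: "r_coeff n = (\<Sum>k=1..?N. (- 1) ^ (k + 1) / fact k * todd (?N - k) * harm k)"
    unfolding r_coeff_def by (intro sum.cong) (auto simp: todd_def of_nat_diff)
  have sum_todd: "(\<Sum>k=-1..int n. of_rat (todd_coeff k) * t powi k) = (\<Sum>i\<le>?N. todd i * t ^ i / t)"
    if "t > 0" for t :: real
  proof (rule sum.reindex_bij_witness[of _ "\<lambda>i. int i - 1" "\<lambda>k. nat (k + 1)"])
    fix k assume k: "k \<in> {-1..int n}"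
    have "t powi (int (nat (k + 1)) - 1) = t ^ nat (k + 1) / t"
      using that unfolding power_int_of_nat[symmetric] by (subst power_int_diff) (auto simp: power_int_of_nat simp del: int_nat_eq)
    with k show "todd (nat (k + 1)) * t ^ nat (k + 1) / t = of_rat (todd_coeff k) * t powi k"
      by (simp add: todd_def)
  qed auto
  \<comment> \<open>The term r_n t^(n+1) contributes r_n e^(-t) to the integrand, hence exactly r_n
    to the integral.\<close>
  have "has_half_line_integral (\<lambda>t. todd_remainder ?N t * exp (- 1 * t) - r_coeff n * exp (- 1 * t))
      (binet ?N 1 - r_coeff n * (1 / 1))"
    by (intro has_half_line_integral_diff has_half_line_integral_cmult has_half_line_integral_binet
        has_half_line_integral_exp) auto
  then have int: "has_half_line_integral (sr_integrand n) (binet ?N 1 - r_coeff n)"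
  proof (rule has_half_line_integral_cong)
    fix t :: real assume t: "t > 0"
    have "(a - b) / t ^ ?N * e - c * e = 1 / t ^ n * (a - b - c * t ^ (n + 1)) * (e / t)" for a b c e
      using t by (simp add: field_simps)
    then show "todd_remainder ?N t * exp (- 1 * t) - r_coeff n * exp (- 1 * t) = sr_integrand n t"
      unfolding sr_integrand_def sum_todd[OF t] todd_remainder_def by simp
  qed simp
  have shift: "(\<Sum>i\<le>n. f (?N - i)) = (\<Sum>p=1..?N. f p)" for f :: "nat \<Rightarrow> real"
    by (rule sum.reindex_bij_witness[of _ "\<lambda>p. ?N - p" "\<lambda>i. ?N - i"]) auto
  have sign: "(- 1 :: real) ^ i = (- 1) ^ n * (- 1) ^ (?N - i + 1)" if "i \<le> n" for i
    using that by (auto simp: minus_one_power_iff)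
  \<comment> \<open>For n > 0 the sum is the difference of a Bernoulli polynomial between 0 and 1,
    equal to 0^n / n! = 0. For n = 0 it is not zero, but \<open>harm 0\<close> is.\<close>
  have "harm n * (\<Sum>i\<le>n. (- 1) ^ i * todd i / fact (?N - i)) = 0"
  proof (cases n)
    case (Suc m)
    have "(\<Sum>i\<le>?N. (- 1) ^ i * todd i * (((0 + 1) ^ (?N - i) - 0 ^ (?N - i)) / fact (?N - i))) = 0"
      unfolding todd_difference_signed using Suc by simp
    moreover have "(\<Sum>i\<le>n. (- 1) ^ i * todd i * (((0 + 1) ^ (?N - i) - 0 ^ (?N - i)) / fact (?N - i)))
      = (\<Sum>i\<le>n. (- 1) ^ i * todd i / fact (?N - i))"
      by (intro sum.cong) auto
    ultimately show ?thesis by simp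
  qed (simp add: harm_def)
  then have "(\<Sum>i\<le>n. (- 1) ^ i * todd i * (1 / fact (?N - i) * (harm n - harm (?N - i))))
      = - (\<Sum>i\<le>n. (- 1) ^ i * todd i / fact (?N - i) * harm (?N - i))"
    by (simp add: right_diff_distrib sum_subtractf sum_distrib_left mult_ac)
  also have "(\<Sum>i\<le>n. (- 1) ^ i * todd i / fact (?N - i) * harm (?N - i)) =
      (- 1) ^ n * (\<Sum>i\<le>n. (- 1) ^ (?N - i + 1) / fact (?N - i) * todd (?N - (?N - i)) * harm (?N - i))"
    unfolding sum_distrib_left by (intro sum.cong refl, subst sign) auto
  also have "\<dots> = (- 1) ^ n * r_coeff n"
    unfolding r shift[of "\<lambda>k. (- 1) ^ (k + 1) / fact k * todd (?N - k) * harm k"] ..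
  finally have const: "(\<Sum>i\<le>n. (- 1) ^ i * todd i * (1 / fact (?N - i) * (harm n - harm (?N - i))))
      = - ((- 1) ^ n * r_coeff n)" .
  have "stirling_ramanujan n = fact n * ((- 1) ^ ?N * todd ?N * harm n) - log_potential n 1"
    unfolding stirling_ramanujan_def using stirling_ramanujan_expansion_exists
    by (intro the_equality) (auto dest: stirling_ramanujan_expansion_unique)
  \<comment> \<open>At 1 the logarithm vanishes, and the summand i = Suc n of
    \<open>log_potential n 1\<close> cancels the separate multiple of \<open>harm n\<close>.\<close>
  also have "\<dots> = - fact n * ((\<Sum>i\<le>n. (- 1) ^ i * todd i * (1 / fact (?N - i) * (harm n - harm (?N - i))))
      + (- 1) ^ n * binet ?N 1)"
    by (simp add: log_potential_def harm_def algebra_simps)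
  also have "\<dots> = (- 1) ^ (n + 1) * fact n * (binet ?N 1 - r_coeff n)"
    unfolding const by (simp add: algebra_simps)
  finally show ?thesis using rat int by (simp add: has_half_line_integral_iff)
qed

end
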